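(* Let $H_0\subseteq\Theta$. If $R(x)$ is a region estimator for $\theta$ with confidence $1-\alpha$ and $\phi_{H_0,R}$ is the agnostic test for $H_0$ based on $R$, then $\phi_{H_0,R}$ is an $(\alpha,\alpha)$-size test.
   Context: Setting: $X$ is the data, taking values in the sample space $\mathcal{X}$; $\mathbb{P}_\theta$ is the distribution of $X$ when the parameter is $\theta\in\Theta$; $H_0\subseteq\Theta$ is the null hypothesis and $H_1=H_0^c=\Theta\setminus H_0$. An agnostic test is a function $\phi:\mathcal{X}\to\{0,\tfrac12,1\}$ ($0$ = accept $H_0$, $1$ = reject $H_0$, $\tfrac12$ = remain agnostic). It has $(\alpha,\beta)$-size if $\sup_{\theta_0\in H_0}\mathbb{P}_{\theta_0}(\phi=1)\le\alpha$ and $\sup_{\theta_1\in H_1}\mathbb{P}_{\theta_1}(\phi=0)\le\beta$. A region estimator is a function $R:\mathcal{X}\to\mathcal{P}(\Theta)$ (the power set of $\Theta$). It has confidence $1-\alpha$ if $\mathbb{P}_\theta(\theta\in R(X))\ge1-\alpha$ for every $\theta\in\Theta$. The agnostic test for $H_0$ based on $R$ is $\phi_{H_0,R}(x)=0$ if $R(x)\subseteq H_0$, $=1$ if $R(x)\subseteq H_0^c$, and $=\tfrac12$ otherwise. *)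

theory Defs
  imports "HOL-Probability.Probability"
begin

text \<open>
  \<open>M\<close> carries the sample space \<open>space M\<close> and its events; \<open>P \<theta>\<close> is the distribution of the data on it
  when the parameter is \<open>\<theta>\<close>, so that an event on the data \<open>X\<close> under \<open>\<theta>\<close> is rendered as
  \<open>\<P>(x in P \<theta>. _)\<close>.
\<close>

locale statistical_model =
  fixes M :: "'x measure" and \<Theta> :: "'p set" and P :: "'p \<Rightarrow> 'x measure"
  assumes prob_space_P: "\<theta> \<in> \<Theta> \<Longrightarrow> prob_space (P \<theta>)"
    and sets_P: "\<theta> \<in> \<Theta> \<Longrightarrow> sets (P \<theta>) = sets M"

definition agnostic_test :: "'x measure \<Rightarrow> ('x \<Rightarrow> real) \<Rightarrow> bool" where
  "agnostic_test M \<phi> \<longleftrightarrow> \<phi> \<in> space M \<rightarrow> {0, 1/2, 1}"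

text \<open>
  The suprema are taken in the extended reals, because one of \<open>H\<^sub>0\<close> and \<open>\<Theta> - H\<^sub>0\<close> may be empty and
  the supremum of an empty set of reals is unspecified.
  Here and below \<open>\<P>\<close> has its usual meaning on events; no measurability is imposed on tests or
  region estimators, and \<open>\<P>\<close> is \<open>0\<close> by the library's convention on sets that are not measurable.
\<close>

definition has_size ::
  "'p set \<Rightarrow> ('p \<Rightarrow> 'x measure) \<Rightarrow> 'p set \<Rightarrow> ('x \<Rightarrow> real) \<Rightarrow> real \<Rightarrow> real \<Rightarrow> bool" where
  "has_size \<Theta> P H\<^sub>0 \<phi> \<alpha> \<beta> \<longleftrightarrow>
     (SUP \<theta>\<^sub>0\<in>H\<^sub>0. ereal (\<P>(x in P \<theta>\<^sub>0. \<phi> x = 1))) \<le> ereal \<alpha> \<and>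
     (SUP \<theta>\<^sub>1\<in>\<Theta> - H\<^sub>0. ereal (\<P>(x in P \<theta>\<^sub>1. \<phi> x = 0))) \<le> ereal \<beta>"

definition region_estimator :: "'x measure \<Rightarrow> 'p set \<Rightarrow> ('x \<Rightarrow> 'p set) \<Rightarrow> bool" where
  "region_estimator M \<Theta> R \<longleftrightarrow> R \<in> space M \<rightarrow> Pow \<Theta>"

definition has_confidence ::
  "'p set \<Rightarrow> ('p \<Rightarrow> 'x measure) \<Rightarrow> ('x \<Rightarrow> 'p set) \<Rightarrow> real \<Rightarrow> bool" where
  "has_confidence \<Theta> P R c \<longleftrightarrow> (\<forall>\<theta>\<in>\<Theta>. \<P>(x in P \<theta>. \<theta> \<in> R x) \<ge> c)"

text \<open>The clauses are read in order, so \<open>R x = {}\<close> yields \<open>0\<close>.\<close>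

definition region_test :: "'p set \<Rightarrow> 'p set \<Rightarrow> ('x \<Rightarrow> 'p set) \<Rightarrow> 'x \<Rightarrow> real" where
  "region_test \<Theta> H\<^sub>0 R x =
     (if R x \<subseteq> H\<^sub>0 then 0 else if R x \<subseteq> \<Theta> - H\<^sub>0 then 1 else 1/2)"

end

theory Submission
  imports Defs
begin

text \<open>
  If \<open>\<phi>\<close> takes the wrong decision at \<open>\<theta>\<close>, then \<open>R x\<close> lies in the hypothesis that does not
  contain \<open>\<theta>\<close>, so \<open>R\<close> misses \<open>\<theta>\<close>; this has probability at most \<open>\<alpha>\<close>.
\<close>

text \<open>Without measurability the bound survives because a set that is not measurable gets measure \<open>0\<close>:
  for \<open>A\<close> this forces \<open>\<alpha> \<ge> 1\<close>, and for \<open>B\<close> only \<open>\<alpha> \<ge> 0\<close> is needed.\<close>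

lemma (in prob_space) prob_le_of_disjoint:
  assumes "A \<inter> B = {}" and "1 - \<alpha> \<le> prob A"
  shows "prob B \<le> \<alpha>"
proof (cases "A \<in> events \<and> B \<in> events")
  case True
  then have "prob A + prob B = prob (A \<union> B)"
    using assms(1) by (simp add: finite_measure_Union)
  then show ?thesis
    using assms(2) prob_le_1[of "A \<union> B"] by linarith
next
  case False
  then have "prob A = 0 \<or> prob B = 0"
    using measure_notin_sets by blast
  then show ?thesis
    using assms(2) prob_le_1[of A] prob_le_1[of B] by linarith
qed

theorem mainTheorem5:
  fixes M :: "'x measure" and \<Theta> H\<^sub>0 :: "'p set" and P :: "'p \<Rightarrow> 'x measure"
    and R :: "'x \<Rightarrow> 'p set" and \<alpha> :: real
  assumes "statistical_model M \<Theta> P"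
    and "H\<^sub>0 \<subseteq> \<Theta>"
    and "region_estimator M \<Theta> R"
    and "has_confidence \<Theta> P R (1 - \<alpha>)"
  shows "agnostic_test M (region_test \<Theta> H\<^sub>0 R)
    \<and> has_size \<Theta> P H\<^sub>0 (region_test \<Theta> H\<^sub>0 R) \<alpha> \<alpha>"
proof
  show "agnostic_test M (region_test \<Theta> H\<^sub>0 R)"
    by (auto simp: agnostic_test_def region_test_def)
  \<comment> \<open>Serves both error bounds: \<open>d\<close> is a decision taken only when the
    region misses \<theta>, so its event is disjoint from the coverage event.\<close>
  have wrong: "\<P>(x in P \<theta>. region_test \<Theta> H\<^sub>0 R x = d) \<le> \<alpha>"
    if "\<theta> \<in> \<Theta>" and "\<And>x. region_test \<Theta> H\<^sub>0 R x = d \<Longrightarrow> \<theta> \<notin> R x" for \<theta> d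
  proof -
    interpret prob_space "P \<theta>"
      using assms(1) that(1) by (rule statistical_model.prob_space_P)
    show ?thesis
    proof (rule prob_le_of_disjoint)
      show "1 - \<alpha> \<le> \<P>(x in P \<theta>. \<theta> \<in> R x)"
        using assms(4) that(1) by (simp add: has_confidence_def)
    qed (use that(2) in auto)
  qed
  have "\<P>(x in P \<theta>. region_test \<Theta> H\<^sub>0 R x = 1) \<le> \<alpha>" if "\<theta> \<in> H\<^sub>0" for \<theta>
    using that assms(2) by (intro wrong) (auto simp: region_test_def split: if_splits)
  \<comment> \<open>The value 0 also arises from \<open>R x = {}\<close>; this is harmless, as the
    empty region misses \<theta> too.\<close>
  moreover have "\<P>(x in P \<theta>. region_test \<Theta> H\<^sub>0 R x = 0) \<le> \<alpha>" if "\<theta> \<in> \<Theta> - H\<^sub>0" for \<theta>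
    using that by (intro wrong) (auto simp: region_test_def split: if_splits)
  \<comment> \<open>In the extended reals the pointwise bounds give the bound on the supremum even
    over an empty index set, where it is minus infinity.\<close>
  ultimately show "has_size \<Theta> P H\<^sub>0 (region_test \<Theta> H\<^sub>0 R) \<alpha> \<alpha>"
    by (simp add: has_size_def SUP_le_iff)
qed

end
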